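(* Consider an instance of the restricted Santa Claus problem with finite set of players $\mathcal P$, finite set of resources $\mathcal R$, values $v_j>0$, and sets $\mathcal R(i)\subseteq\mathcal R$. For $S\subseteq\mathcal R$ write $v(S)=\sum_{j\in S}v_j$; let $\mathcal C(i,\tau)=\{S\subseteq\mathcal R(i): v(S)\ge\tau\}$ and let $\mathrm{OPT}^*$ be the largest $\tau$ for which the configuration LP \[ \sum_{C\in\mathcal C(i,\tau)} x_{i,C}\ge 1\ \ \forall i\in\mathcal P,\qquad \sum_{i\in\mathcal P}\sum_{C\in\mathcal C(i,\tau):\, j\in C} x_{i,C}\le 1\ \ \forall j\in\mathcal R,\qquad x_{i,C}\ge 0 \] is feasible, and let $\alpha=3+5/6$. Run the local search algorithm described below on a matching $M$ of the hypergraph $\mathcal H$ and a player $i_0\in\mathcal P$ not covered by $M$. Then, as long as $i_0$ is not matched (i.e. the algorithm has not returned), whenever the algorithm reaches the selection step there exists an edge $e\in\mathcal H\setminus M$ with $e_{\mathcal R}\cap\big(A_{\mathcal R}\cup B_M(A)_{\mathcal R}\big)=\emptyset$ and $e_{\mathcal P}\in B_M(A)_{\mathcal P}\cup\{i_0\}$, i.e. an edge that can be added to $A$.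
   Context: Hypergraph: $\mathcal H$ consists of all pairs $e=(i,C)$ with $i\in\mathcal P$, $C\subseteq\mathcal R(i)$, $v(C)\ge\mathrm{OPT}^*/\alpha$, and $v(C')<\mathrm{OPT}^*/\alpha$ for every proper subset $C'\subsetneq C$ (minimal edges). For an edge $e=(i,C)$ write $e_{\mathcal P}=i$ and $e_{\mathcal R}=C$; for a set $F$ of edges, $F_{\mathcal P}$ and $F_{\mathcal R}$ are the sets of players and the union of resources of edges in $F$. A matching is a set of edges that pairwise share no player and no resource. For a matching $M$ and an edge $e$, $B_M(e)=\{e'\in M: e'_{\mathcal R}\cap e_{\mathcal R}\neq\emptyset\}$, and for a list $A$ of edges $B_M(A)=\bigcup_{e\in A}B_M(e)$. Algorithm (input: matching $M$, player $i_0\notin M_{\mathcal P}$): maintain an ordered list $A=(e^A_1,\dots,e^A_\ell)$, initially empty with $\ell=0$. Repeat: set $\ell\gets\ell+1$; (selection step) choose $e^A_\ell\in\mathcal H\setminus M$ with $(e^A_\ell)_{\mathcal R}\cap(A_{\mathcal R}\cup B_M(A)_{\mathcal R})=\emptyset$ and $(e^A_\ell)_{\mathcal P}\in B_M(A)_{\mathcal P}\cup\{i_0\}$, and append it to $A$. Then, while $B_M(e^A_\ell)=\emptyset$: if some $e'\in B_M(A)$ has $e'_{\mathcal P}=(e^A_\ell)_{\mathcal P}$, let $k$ be the index with $e'\in B_M(e^A_k)$, set $M\gets (M\setminus\{e'\})\cup\{e^A_\ell\}$, $A\gets(e^A_1,\dots,e^A_k)$ and $\ell\gets k$; otherwise (then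 $(e^A_\ell)_{\mathcal P}=i_0$) set $M\gets M\cup\{e^A_\ell\}$ and return $M$. *)

theory Defs
  imports Complex_Main
begin

section \<open>The configuration LP of the restricted Santa Claus problem\<close>

text \<open>
  An instance is given by the set \<open>P\<close> of players, the set \<open>R\<close> of resources, the values \<open>v\<close> and
  the sets \<open>Rs i\<close> of resources that player \<open>i\<close> may receive.
\<close>

definition configs :: "('r \<Rightarrow> real) \<Rightarrow> ('p \<Rightarrow> 'r set) \<Rightarrow> 'p \<Rightarrow> real \<Rightarrow> 'r set set" where
  "configs v Rs i \<tau> = {S. S \<subseteq> Rs i \<and> sum v S \<ge> \<tau>}"

definition lp_feasible ::
  "'p set \<Rightarrow> 'r set \<Rightarrow> ('r \<Rightarrow> real) \<Rightarrow> ('p \<Rightarrow> 'r set) \<Rightarrow> real \<Rightarrow> bool" where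
  "lp_feasible P R v Rs \<tau> \<longleftrightarrow>
     (\<exists>x :: 'p \<Rightarrow> 'r set \<Rightarrow> real.
        (\<forall>i\<in>P. (\<Sum>C\<in>configs v Rs i \<tau>. x i C) \<ge> 1) \<and>
        (\<forall>j\<in>R. (\<Sum>i\<in>P. \<Sum>C\<in>{C \<in> configs v Rs i \<tau>. j \<in> C}. x i C) \<le> 1) \<and>
        (\<forall>i\<in>P. \<forall>C\<in>configs v Rs i \<tau>. x i C \<ge> 0))"

text \<open>The maximum exists for a finite instance with at least one player; see
  \<open>lp_opt_greatest\<close> below.\<close>

definition lp_opt :: "'p set \<Rightarrow> 'r set \<Rightarrow> ('r \<Rightarrow> real) \<Rightarrow> ('p \<Rightarrow> 'r set) \<Rightarrow> real" where
  "lp_opt P R v Rs = (GREATEST \<tau>. lp_feasible P R v Rs \<tau>)"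

lemma lp_opt_greatest:
  assumes fin: "finite P" "finite R" and ne: "P \<noteq> {}" and sub: "\<And>i. i \<in> P \<Longrightarrow> Rs i \<subseteq> R"
  shows "lp_feasible P R v Rs (lp_opt P R v Rs)"
    and "lp_feasible P R v Rs \<tau> \<Longrightarrow> \<tau> \<le> lp_opt P R v Rs"
proof -
  let ?F = "lp_feasible P R v Rs"
  define T where "T = sum v ` Pow R"
  have finT: "finite T" unfolding T_def using fin by simp
  have fin_configs: "finite (configs v Rs i t)" if "i \<in> P" for i t
    by (rule finite_subset[of _ "Pow R"]) (use sub[OF that] fin in \<open>auto simp: configs_def\<close>)
  have up: "\<exists>t\<in>T. ?F t \<and> s \<le> t" if F: "?F s" for s
  proof -
    obtain i where i: "i \<in> P" using ne by blast
    have "configs v Rs i s \<noteq> {}"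
    proof
      assume "configs v Rs i s = {}"
      with F i show False by (auto simp: lp_feasible_def)
    qed
    then obtain S where "S \<subseteq> R" "sum v S \<ge> s" using sub[OF i] by (auto simp: configs_def)
    then have ne': "{t \<in> T. s \<le> t} \<noteq> {}" unfolding T_def by blast
    define t where "t = Min {t \<in> T. s \<le> t}"
    have t: "t \<in> T" "s \<le> t" using Min_in[OF _ ne'] finT by (auto simp: t_def)
    have le: "t \<le> sum v S" if "S \<subseteq> R" "s \<le> sum v S" for S
      unfolding t_def by (rule Min_le) (use that finT in \<open>auto simp: T_def\<close>)
    have eq: "configs v Rs i' t = configs v Rs i' s" if "i' \<in> P" for i'
      using le sub[OF that] t(2) by (fastforce simp: configs_def)
    have "?F t" using F by (simp add: lp_feasible_def eq cong: ball_cong sum.cong)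
    then show ?thesis using t by blast
  qed
  have F0: "?F 0"
    unfolding lp_feasible_def
  proof (intro exI[of _ "\<lambda>i C. if C = {} then 1 else 0"] conjI ballI)
    fix i assume i: "i \<in> P"
    have "{} \<in> configs v Rs i 0" by (simp add: configs_def)
    then show "1 \<le> (\<Sum>C\<in>configs v Rs i 0. if C = {} then 1 else (0::real))"
      using fin_configs[OF i] by (simp add: sum.delta)
  next
    fix j assume "j \<in> R"
    have "(\<Sum>i\<in>P. \<Sum>C\<in>{C \<in> configs v Rs i 0. j \<in> C}. if C = {} then 1 else (0::real)) = 0"
      by (intro sum.neutral ballI) auto
    then show "(\<Sum>i\<in>P. \<Sum>C\<in>{C \<in> configs v Rs i 0. j \<in> C}. if C = {} then 1 else (0::real)) \<le> 1"
      by simp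
  qed auto
  define m where "m = Max {t \<in> T. ?F t}"
  have ne': "{t \<in> T. ?F t} \<noteq> {}" using up[OF F0] by blast
  have m: "?F m" using Max_in[OF _ ne'] finT by (auto simp: m_def)
  have max: "s \<le> m" if s: "?F s" for s
  proof -
    obtain t where t: "t \<in> T" "?F t" "s \<le> t" using up[OF s] by blast
    then have "t \<le> m" unfolding m_def using finT by (intro Max_ge) auto
    with t(3) show ?thesis by simp
  qed
  have opt: "lp_opt P R v Rs = m" unfolding lp_opt_def using m max by (rule Greatest_equality)
  show "?F (lp_opt P R v Rs)" using m opt by simp
  show "?F \<tau> \<Longrightarrow> \<tau> \<le> lp_opt P R v Rs" using max opt by simp
qed

section \<open>The hypergraph of minimal edges\<close>

text \<open>An edge \<open>(i, C)\<close> consists of a player and a set of resources.\<close>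

type_synonym ('p, 'r) edge = "'p \<times> 'r set"

definition alpha :: real where
  "alpha = 3 + 5 / 6"

definition hyperedges ::
  "'p set \<Rightarrow> 'r set \<Rightarrow> ('r \<Rightarrow> real) \<Rightarrow> ('p \<Rightarrow> 'r set) \<Rightarrow> ('p, 'r) edge set" where
  "hyperedges P R v Rs =
     {(i, C). i \<in> P \<and> C \<subseteq> Rs i \<and> sum v C \<ge> lp_opt P R v Rs / alpha \<and>
              (\<forall>C'. C' \<subset> C \<longrightarrow> sum v C' < lp_opt P R v Rs / alpha)}"

definition players :: "('p, 'r) edge set \<Rightarrow> 'p set" where
  "players F = fst ` F"

definition resources :: "('p, 'r) edge set \<Rightarrow> 'r set" where
  "resources F = (\<Union>e\<in>F. snd e)"

definition matching :: "('p, 'r) edge set \<Rightarrow> ('p, 'r) edge set \<Rightarrow> bool" where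
  "matching H M \<longleftrightarrow>
     M \<subseteq> H \<and> (\<forall>e\<in>M. \<forall>e'\<in>M. e \<noteq> e' \<longrightarrow> fst e \<noteq> fst e' \<and> snd e \<inter> snd e' = {})"

definition blocking :: "('p, 'r) edge set \<Rightarrow> ('p, 'r) edge \<Rightarrow> ('p, 'r) edge set" where
  "blocking M e = {e' \<in> M. snd e' \<inter> snd e \<noteq> {}}"

definition blocking_list :: "('p, 'r) edge set \<Rightarrow> ('p, 'r) edge list \<Rightarrow> ('p, 'r) edge set" where
  "blocking_list M A = (\<Union>e\<in>set A. blocking M e)"

section \<open>The local search algorithm\<close>

text \<open>
  The algorithm is a nondeterministic transition system. In \<open>Select M A\<close> it is about to choose the
  next edge to be appended to \<open>A\<close>, in \<open>Check M A\<close> it is about to test the condition of the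
  inner while loop on the last edge of \<open>A\<close>, and in \<open>Return M\<close> it has returned \<open>M\<close>.
  The list \<open>A\<close> is indexed from \<open>0\<close>, so \<open>take (Suc k) A\<close> cuts \<open>A\<close> after the edge \<open>A ! k\<close>.
\<close>

datatype ('p, 'r) state =
    Select "('p, 'r) edge set" "('p, 'r) edge list"
  | Check "('p, 'r) edge set" "('p, 'r) edge list"
  | Return "('p, 'r) edge set"

inductive step :: "('p, 'r) edge set \<Rightarrow> 'p \<Rightarrow> ('p, 'r) state \<Rightarrow> ('p, 'r) state \<Rightarrow> bool"
  for H :: "('p, 'r) edge set" and i0 :: 'p where
  select: "step H i0 (Select M A) (Check M (A @ [e]))"
    if "e \<in> H - M"
      and "snd e \<inter> (resources (set A) \<union> resources (blocking_list M A)) = {}"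
      and "fst e \<in> players (blocking_list M A) \<union> {i0}"
| blocked: "step H i0 (Check M A) (Select M A)"
    if "A \<noteq> []" and "blocking M (last A) \<noteq> {}"
| swap: "step H i0 (Check M A) (Check ((M - {e'}) \<union> {last A}) (take (Suc k) A))"
    if "A \<noteq> []" and "blocking M (last A) = {}"
      and "e' \<in> blocking_list M A" and "fst e' = fst (last A)"
      and "k < length A" and "e' \<in> blocking M (A ! k)"
| finish: "step H i0 (Check M A) (Return (M \<union> {last A}))"
    if "A \<noteq> []" and "blocking M (last A) = {}"
      and "\<not> (\<exists>e'\<in>blocking_list M A. fst e' = fst (last A))"

end

theory Submission
  imports Defs
begin

text \<open>
  If \<open>OPT\<^sup>* = 0\<close>, the edge \<open>(i\<^sub>0, {})\<close> can be added. Otherwise scale the values so that edges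
  have value at least \<open>1\<close> and \<open>OPT\<^sup>* = 23/6\<close>. If no edge can be added, the following
  is a certificate that the configuration LP is infeasible: every player of a blocking
  edge, and \<open>i\<^sub>0\<close>, gets dual value \<open>1\<close>; every resource \<open>j\<close> in \<open>X\<close>, the resources of the edges in \<open>A\<close>
  and of their blocking edges, gets dual value \<open>1\<close> if it forms an edge on its own, and
  \<open>min (1/3) (2/5 v\<^sub>j)\<close> otherwise. A configuration of one of these players has value less than \<open>1\<close>
  outside \<open>X\<close>, hence more than \<open>17/6\<close> inside, and this forces its dual value to be at least \<open>1\<close>.
  On the other hand an edge \<open>e\<close> of \<open>A\<close> together with its blocking edges has dual value at most
  \<open>card (B\<^sub>M e)\<close>; as the sets \<open>B\<^sub>M e\<close> are disjoint, the resources have smaller total dual value than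
  the players.
\<close>

section \<open>The dual values of the resources\<close>

definition minimal_heavy :: "('r \<Rightarrow> real) \<Rightarrow> 'r set \<Rightarrow> bool" where
  "minimal_heavy w C \<longleftrightarrow> sum w C \<ge> 1 \<and> (\<forall>C'. C' \<subset> C \<longrightarrow> sum w C' < 1)"

text \<open>The slope \<open>2/5\<close> prices a total value of \<open>5/2\<close> at
  \<open>1\<close>; the cap \<open>1/3\<close> prices three resources of value below
  \<open>1\<close> at no more than \<open>1\<close>. The two regimes meet at
  \<open>5/6\<close>.\<close>

definition dual_val :: "real \<Rightarrow> real" where
  "dual_val x = (if x \<ge> 1 then 1 else min (1/3) (2 * x / 5))"

lemma dual_val_nonneg: "x \<ge> 0 \<Longrightarrow> dual_val x \<ge> 0"
  by (simp add: dual_val_def)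

lemma dual_val_le_third: "x < 1 \<Longrightarrow> dual_val x \<le> 1/3"
  by (simp add: dual_val_def)

lemma dual_val_le_linear: "x < 1 \<Longrightarrow> dual_val x \<le> 2/5 * x"
  by (simp add: dual_val_def)

text \<open>\<open>sum\<close> is \<open>0\<close> on an infinite set, so a value of at least
  \<open>1\<close> forces finiteness.\<close>

lemma minimal_heavy_finite: "minimal_heavy w C \<Longrightarrow> finite C"
  by (rule ccontr) (auto simp: minimal_heavy_def)

lemma minimal_heavy_nonempty: "minimal_heavy w C \<Longrightarrow> C \<noteq> {}"
  by (auto simp: minimal_heavy_def)

lemma minimal_heavy_singleton:
  assumes "minimal_heavy w C" "j \<in> C" "w j \<ge> 1"
  shows "C = {j}"
proof (rule ccontr)
  assume "C \<noteq> {j}"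
  then have "{j} \<subset> C" using assms(2) by blast
  then have "sum w {j} < 1" using assms(1) unfolding minimal_heavy_def by blast
  then show False using assms(3) by simp
qed

lemma minimal_heavy_sum_less:
  assumes "minimal_heavy w C" "j \<in> C"
  shows "sum w C < 1 + w j"
proof -
  have "C - {j} \<subset> C" using assms(2) by blast
  then have "sum w (C - {j}) < 1" using assms(1) unfolding minimal_heavy_def by blast
  then show ?thesis
    using sum.remove[OF minimal_heavy_finite[OF assms(1)] assms(2), of w] by simp
qed

text \<open>One resource alone stays below \<open>1\<close>, while any two exceed \<open>1\<close>
  and so cannot form a proper subset.\<close>

lemma minimal_heavy_pair:
  assumes C: "minimal_heavy w C" and a: "a \<in> C" and half: "\<And>j. j \<in> C \<Longrightarrow> 1/2 < w j \<and> w j < 1"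
  obtains b where "b \<noteq> a" "C = {a, b}"
proof -
  have "C \<noteq> {a}"
  proof
    assume "C = {a}"
    then show False using C half[OF a] by (simp add: minimal_heavy_def)
  qed
  then obtain b where b: "b \<in> C" "b \<noteq> a" using a by blast
  have "\<not> {a, b} \<subset> C"
  proof
    assume "{a, b} \<subset> C"
    then have "sum w {a, b} < 1" using C unfolding minimal_heavy_def by blast
    then show False using b half[OF a] half[OF b(1)] by simp
  qed
  then have "C = {a, b}" using a b by blast
  then show ?thesis using that b(2) by blast
qed

text \<open>Descent through proper subsets of value at least \<open>1\<close>; this is how free
  resources of enough value yield an edge.\<close>

lemma exists_minimal_heavy_subset:
  assumes "finite D" "sum w D \<ge> 1"
  shows "\<exists>C\<subseteq>D. minimal_heavy w C"
  using assms
proof (induction D rule: finite_psubset_induct)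
  case (psubset D)
  show ?case
  proof (cases "minimal_heavy w D")
    case True
    then show ?thesis by (intro exI[of _ D]) simp
  next
    case False
    then obtain D' where D': "D' \<subset> D" "sum w D' \<ge> 1"
      using psubset.prems unfolding minimal_heavy_def not_less[symmetric] by blast
    then obtain C where "C \<subseteq> D'" "minimal_heavy w C" using psubset.IH[OF D'] by (elim exE conjE)
    then show ?thesis using D'(1) by (intro exI[of _ C]) auto
  qed
qed

lemma sum_UN_le_sum:
  fixes g :: "'r \<Rightarrow> real"
  assumes "finite I" "\<And>i. i \<in> I \<Longrightarrow> finite (N i)"
    and "\<And>j. j \<in> (\<Union>i\<in>I. N i) \<Longrightarrow> g j \<ge> 0"
  shows "sum g (\<Union>i\<in>I. N i) \<le> (\<Sum>i\<in>I. sum g (N i))"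
  using assms
proof (induction I rule: finite_induct)
  case (insert i I)
  let ?U = "\<Union>i\<in>I. N i"
  have fin: "finite (N i)" "finite ?U" using insert by auto
  have "sum g (N i \<union> ?U) + sum g (N i \<inter> ?U) = sum g (N i) + sum g ?U"
    using sum.union_inter[OF fin] .
  moreover have "sum g (N i \<inter> ?U) \<ge> 0" using insert.prems by (intro sum_nonneg) auto
  moreover have "sum g ?U \<le> (\<Sum>i\<in>I. sum g (N i))" using insert by simp
  ultimately show ?case using insert.hyps by simp
qed simp

text \<open>One resource of value at least \<open>1\<close> suffices. Otherwise \<open>k\<close>
  capped resources leave more than \<open>17/6 - k\<close> priced at rate \<open>2/5\<close>. The
  bound \<open>k/3 + 2/5 * (17/6 - k)\<close> is exactly \<open>1\<close> at \<open>k = 2\<close>,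
  which explains \<open>17/6\<close>.\<close>

lemma dual_val_cover:
  assumes fin: "finite C" and nonneg: "\<And>j. j \<in> C \<Longrightarrow> w j \<ge> 0" and large: "sum w C > 17/6"
  shows "(\<Sum>j\<in>C. dual_val (w j)) \<ge> 1"
proof -
  have dn: "dual_val (w j) \<ge> 0" if "j \<in> C" for j using dual_val_nonneg nonneg that by blast
  show ?thesis
  proof (cases "\<exists>j\<in>C. w j \<ge> 1")
    case True
    then obtain j where j: "j \<in> C" "w j \<ge> 1" by blast
    have "dual_val (w j) \<le> (\<Sum>j\<in>C. dual_val (w j))"
      using member_le_sum[of j C "\<lambda>j. dual_val (w j)"] j fin dn by auto
    then show ?thesis using j by (simp add: dual_val_def)
  next
    case False
    define K where "K = {j \<in> C. w j > 5/6}"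
    define L where "L = C - K"
    have finK: "finite K" "finite L" and CKL: "C = K \<union> L" "K \<inter> L = {}"
      using fin by (auto simp: K_def L_def)
    have dK: "(\<Sum>j\<in>K. dual_val (w j)) = card K / 3"
    proof -
      have "(\<Sum>j\<in>K. dual_val (w j)) = (\<Sum>j\<in>K. 1/3)"
        using False by (intro sum.cong) (auto simp: K_def dual_val_def)
      then show ?thesis by simp
    qed
    have dL: "(\<Sum>j\<in>L. dual_val (w j)) = 2/5 * sum w L"
      unfolding sum_distrib_left
      using False by (intro sum.cong) (auto simp: K_def L_def dual_val_def)
    have wK: "sum w K \<le> card K"
    proof -
      have "sum w K \<le> (\<Sum>j\<in>K. 1)" using False by (intro sum_mono) (auto simp: K_def)
      then show ?thesis by simp
    qed
    have "sum w L \<ge> 0" using nonneg by (intro sum_nonneg) (auto simp: L_def)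
    moreover have "sum w L > 17/6 - card K"
      using large wK sum.union_disjoint[OF finK CKL(2), of w] CKL(1) by simp
    moreover have "(\<Sum>j\<in>C. dual_val (w j)) = card K / 3 + 2/5 * sum w L"
      using dK dL sum.union_disjoint[OF finK CKL(2), of "\<lambda>j. dual_val (w j)"] CKL(1) by simp
    \<comment> \<open>From three capped resources on, the caps alone give \<open>1\<close>.\<close>
    moreover have "card K = 0 \<or> card K = 1 \<or> card K = 2 \<or> card K \<ge> 3" by linarith
    ultimately show ?thesis by auto
  qed
qed

text \<open>The linear bound on \<open>dual_val\<close> suffices if \<open>e \<union> b\<close> has value at most \<open>5/2\<close>. This can fail only if
  \<open>b\<close> consists of two resources of value above \<open>1/2\<close>; there the cap \<open>1/3\<close> is needed.\<close>

lemma dual_val_pack_single: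
  assumes e: "minimal_heavy w e" and b: "minimal_heavy w b" and meet: "b \<inter> e \<noteq> {}"
    and thin: "\<And>j. j \<in> e \<union> b \<Longrightarrow> w j < 1"
    and nonneg: "\<And>j. j \<in> e \<union> b \<Longrightarrow> w j \<ge> 0"
  shows "(\<Sum>j\<in>e \<union> b. dual_val (w j)) \<le> 1"
proof -
  have fin: "finite e" "finite b" using e b minimal_heavy_finite by auto
  obtain a where a: "a \<in> b" "a \<in> e" using meet by blast
  have linear: "(\<Sum>j\<in>S. dual_val (w j)) \<le> 2/5 * sum w S" if "S \<subseteq> e \<union> b" for S
    unfolding sum_distrib_left using that thin by (intro sum_mono dual_val_le_linear) auto
  have split: "sum w (e \<union> b) = sum w (e - b) + sum w b"
    using sum.union_disjoint[of "e - b" b w] fin by auto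
  \<comment> \<open>The shared resource \<open>a\<close> is counted with \<open>b\<close>, so
    \<open>e\<close> adds less than \<open>1\<close>.\<close>
  have "e - b \<subset> e" using a by blast
  then have diff: "sum w (e - b) < 1" using e unfolding minimal_heavy_def by blast
  consider (small_b) j where "j \<in> b" "w j \<le> 1/2"
    | (small_e) j where "j \<in> e" "w j \<le> 1/2" "\<forall>j\<in>b. w j > 1/2"
    | (half) "\<forall>j\<in>e \<union> b. w j > 1/2"
    by (meson Un_iff not_less)
  then show ?thesis
  proof cases
    case small_b
    then have "sum w (e \<union> b) \<le> 5/2"
      using minimal_heavy_sum_less[OF b] split diff by fastforce
    then show ?thesis using linear[of "e \<union> b"] by simp
  next
    case small_e
    \<comment> \<open>Beyond \<open>e\<close> there is at most the resource \<open>a'\<close>,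
      capped at \<open>1/3\<close>; \<open>e\<close> has value below \<open>3/2\<close> and costs at
      most \<open>3/5\<close>.\<close>
    obtain a' where a': "a' \<noteq> a" "b = {a, a'}"
      using minimal_heavy_pair[OF b a(1)] small_e(3) thin by blast
    have we: "sum w e < 3/2" using minimal_heavy_sum_less[OF e small_e(1)] small_e(2) by simp
    have "e \<union> b = insert a' e" using a a' by blast
    moreover have "dual_val (w a') \<le> 1/3" "0 \<le> dual_val (w a')"
      using a' thin nonneg dual_val_le_third dual_val_nonneg by auto
    ultimately have "(\<Sum>j\<in>e \<union> b. dual_val (w j)) \<le> 1/3 + (\<Sum>j\<in>e. dual_val (w j))"
      using fin by (cases "a' \<in> e") (auto simp: insert_absorb)
    then show ?thesis using linear[of e] we by simp
  next
    case half
    obtain a' where a': "b = {a, a'}"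
      using minimal_heavy_pair[OF b a(1)] half thin by blast
    obtain c where c: "e = {a, c}"
      using minimal_heavy_pair[OF e a(2)] half thin by blast
    \<comment> \<open>Two pairs sharing \<open>a\<close> have at most three resources, each costing
      at most \<open>1/3\<close>.\<close>
    have "e \<union> b = set [a, a', c]" using a' c by auto
    then have card: "card (e \<union> b) \<le> 3" using card_length[of "[a, a', c]"] by simp
    have "(\<Sum>j\<in>e \<union> b. dual_val (w j)) \<le> of_nat (card (e \<union> b)) * (1/3)"
      using thin dual_val_le_third by (intro sum_bounded_above) auto
    then show ?thesis using card by simp
  qed
qed

text \<open>A resource of value at least \<open>1\<close> in \<open>e\<close> is all of
  \<open>e\<close> and of every \<open>S b\<close>, so the union costs \<open>1\<close>. Otherwise a
  single blocking edge is the delicate case, and for more of them the linear bound suffices.\<close>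

lemma dual_val_pack:
  assumes e: "minimal_heavy w e" and B: "finite B" "B \<noteq> {}"
    and b: "\<And>b. b \<in> B \<Longrightarrow> minimal_heavy w (S b) \<and> S b \<inter> e \<noteq> {}"
    and nonneg: "\<And>j. j \<in> e \<union> (\<Union>b\<in>B. S b) \<Longrightarrow> w j \<ge> 0"
  shows "(\<Sum>j\<in>e \<union> (\<Union>b\<in>B. S b). dual_val (w j)) \<le> card B"
proof (cases "\<exists>j\<in>e. w j \<ge> 1")
  case True
  then obtain j where j: "j \<in> e" "w j \<ge> 1" by blast
  have ej: "e = {j}" using minimal_heavy_singleton[OF e j] .
  have "S b = {j}" if "b \<in> B" for b
    using minimal_heavy_singleton[of w "S b" j] b[OF that] ej j by blast
  then have U: "e \<union> (\<Union>b\<in>B. S b) = {j}" using ej by auto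
  have "card B \<ge> 1" using B by (simp add: Suc_leI card_gt_0_iff)
  then show ?thesis unfolding U using j by (simp add: dual_val_def)
next
  case False
  \<comment> \<open>A resource of value at least \<open>1\<close> in some \<open>S b'\<close> would
    be all of \<open>S b'\<close>, hence lie in \<open>e\<close>.\<close>
  have thin: "w j < 1" if j: "j \<in> e \<union> (\<Union>b\<in>B. S b)" for j
  proof (rule ccontr)
    assume "\<not> w j < 1"
    then have "w j \<ge> 1" by simp
    then obtain b' where b': "b' \<in> B" "j \<in> S b'" using j False by blast
    have "S b' = {j}"
      using minimal_heavy_singleton[OF conjunct1[OF b[OF b'(1)]] b'(2) \<open>w j \<ge> 1\<close>] .
    then have "j \<in> e" using b[OF b'(1)] by auto
    then show False using False \<open>w j \<ge> 1\<close> by blast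
  qed
  have "card B \<noteq> 0" using B by simp
  then consider "card B = 1" | "card B \<ge> 2" by linarith
  then show ?thesis
  proof cases
    case 1
    then obtain b' where "B = {b'}" using card_1_singletonE by blast
    then show ?thesis using dual_val_pack_single[of w e "S b'"] e b thin nonneg by simp
  next
    case 2
    define U where "U = (\<Union>b\<in>B. S b)"
    have fin: "finite e" "finite U" using e b B minimal_heavy_finite by (auto simp: U_def)
    obtain b0 where b0: "b0 \<in> B" using B by blast
    have "e - U \<subset> e" using b[OF b0] b0 by (auto simp: U_def)
    then have diff: "sum w (e - U) < 1" using e unfolding minimal_heavy_def by blast
    have "sum w (S b) \<le> 2" if bB: "b \<in> B" for b
    proof -
      obtain j where "j \<in> S b" using b[OF bB] by blast
      then show ?thesis using minimal_heavy_sum_less[of w "S b" j] b[OF bB] thin[of j] bB by force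
    qed
    moreover have "sum w U \<le> (\<Sum>b\<in>B. sum w (S b))"
      unfolding U_def using B b minimal_heavy_finite nonneg by (intro sum_UN_le_sum) auto
    ultimately have wU: "sum w U \<le> card B * 2"
      using sum_bounded_above[of B "\<lambda>b. sum w (S b)" 2] by fastforce
    have "(\<Sum>j\<in>e \<union> U. dual_val (w j)) \<le> 2/5 * sum w (e \<union> U)"
      unfolding sum_distrib_left using thin
      by (intro sum_mono dual_val_le_linear) (auto simp: U_def)
    also have "sum w (e \<union> U) = sum w (e - U) + sum w U"
      using sum.union_disjoint[of "e - U" U w] fin by auto
    also have "2/5 * (sum w (e - U) + sum w U) \<le> 2/5 * (1 + card B * 2)"
      using diff wU by simp
    \<comment> \<open>\<open>2/5 * (1 + 2 * n)\<close> is at most \<open>n\<close> exactly from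
      \<open>n = 2\<close> on.\<close>
    also have "\<dots> \<le> card B" using 2 by simp
    finally show ?thesis by (simp add: U_def)
  qed
qed

section \<open>Weak duality for the configuration LP\<close>

text \<open>Weight the inequalities \<open>y i \<le> sum z C\<close> by \<open>x i C\<close> and
  exchange the sums; the primal constraints bound both ends.\<close>

lemma lp_feasible_weak_duality:
  fixes y :: "'p \<Rightarrow> real" and z :: "'r \<Rightarrow> real"
  assumes feas: "lp_feasible P R v Rs \<tau>" and fin: "finite P" "finite R"
    and sub: "\<And>i. i \<in> P \<Longrightarrow> Rs i \<subseteq> R"
    and z: "\<And>j. j \<in> R \<Longrightarrow> z j \<ge> 0"
    and y: "\<And>i. i \<in> P \<Longrightarrow> y i \<ge> 0"
    and yz: "\<And>i C. i \<in> P \<Longrightarrow> C \<in> configs v Rs i \<tau> \<Longrightarrow> y i \<le> sum z C"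
  shows "sum y P \<le> sum z R"
proof -
  obtain x :: "'p \<Rightarrow> 'r set \<Rightarrow> real" where
      x1: "\<And>i. i \<in> P \<Longrightarrow> (\<Sum>C\<in>configs v Rs i \<tau>. x i C) \<ge> 1"
    and x2: "\<And>j. j \<in> R \<Longrightarrow> (\<Sum>i\<in>P. \<Sum>C\<in>{C \<in> configs v Rs i \<tau>. j \<in> C}. x i C) \<le> 1"
    and x0: "\<And>i C. i \<in> P \<Longrightarrow> C \<in> configs v Rs i \<tau> \<Longrightarrow> x i C \<ge> 0"
    using feas unfolding lp_feasible_def by blast
  have subC: "C \<subseteq> R" if "i \<in> P" "C \<in> configs v Rs i \<tau>" for i C
    using that sub by (auto simp: configs_def)
  have finC: "finite (configs v Rs i \<tau>)" if "i \<in> P" for i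
    by (rule finite_subset[of _ "Pow R"]) (use subC that fin in auto)
  have "sum y P \<le> (\<Sum>i\<in>P. \<Sum>C\<in>configs v Rs i \<tau>. x i C * sum z C)"
  proof (rule sum_mono)
    fix i assume i: "i \<in> P"
    have "y i \<le> (\<Sum>C\<in>configs v Rs i \<tau>. x i C) * y i"
      using mult_right_mono[OF x1[OF i] y[OF i]] by simp
    also have "\<dots> \<le> (\<Sum>C\<in>configs v Rs i \<tau>. x i C * sum z C)"
      unfolding sum_distrib_right using x0 yz i by (intro sum_mono mult_left_mono) auto
    finally show "y i \<le> (\<Sum>C\<in>configs v Rs i \<tau>. x i C * sum z C)" .
  qed
  also have "\<dots> = (\<Sum>i\<in>P. \<Sum>j\<in>R. z j * (\<Sum>C\<in>{C \<in> configs v Rs i \<tau>. j \<in> C}. x i C))"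
  proof (rule sum.cong[OF refl])
    fix i assume i: "i \<in> P"
    have "(\<Sum>C\<in>configs v Rs i \<tau>. x i C * sum z C)
        = (\<Sum>C\<in>configs v Rs i \<tau>. \<Sum>j\<in>{j \<in> R. j \<in> C}. x i C * z j)"
    proof (rule sum.cong[OF refl])
      fix C assume "C \<in> configs v Rs i \<tau>"
      then have "{j \<in> R. j \<in> C} = C" using subC[OF i] by blast
      then show "x i C * sum z C = (\<Sum>j\<in>{j \<in> R. j \<in> C}. x i C * z j)"
        by (simp add: sum_distrib_left)
    qed
    also have "\<dots> = (\<Sum>j\<in>R. \<Sum>C\<in>{C \<in> configs v Rs i \<tau>. j \<in> C}. x i C * z j)"
      using finC[OF i] fin by (intro sum.swap_restrict) auto
    finally show "(\<Sum>C\<in>configs v Rs i \<tau>. x i C * sum z C)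
        = (\<Sum>j\<in>R. z j * (\<Sum>C\<in>{C \<in> configs v Rs i \<tau>. j \<in> C}. x i C))"
      by (simp add: sum_distrib_left mult.commute)
  qed
  also have "\<dots> = (\<Sum>j\<in>R. z j * (\<Sum>i\<in>P. \<Sum>C\<in>{C \<in> configs v Rs i \<tau>. j \<in> C}. x i C))"
    by (subst sum.swap) (simp add: sum_distrib_left)
  also have "\<dots> \<le> (\<Sum>j\<in>R. z j * 1)"
    using z x2 by (intro sum_mono mult_left_mono) auto
  finally show ?thesis by simp
qed

section \<open>Invariants of the local search\<close>

text \<open>Blocking sets refer to the current \<open>M\<close>, not to the matching at the time of
  selection, so an exchange must be shown to preserve the condition.\<close>

definition list_inv :: "('p, 'r) edge set \<Rightarrow> 'p \<Rightarrow> ('p, 'r) edge set \<Rightarrow> ('p, 'r) edge list \<Rightarrow> bool" where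
  "list_inv H i0 M A \<longleftrightarrow>
     matching H M \<and> i0 \<notin> players M \<and> set A \<subseteq> H \<and>
     sorted_wrt (\<lambda>e e'. snd e' \<inter> (snd e \<union> resources (blocking M e)) = {}) A"

text \<open>In \<open>Check\<close> the last edge is yet to be tested, hence
  \<open>butlast\<close>.\<close>

fun state_inv :: "('p, 'r) edge set \<Rightarrow> 'p \<Rightarrow> ('p, 'r) state \<Rightarrow> bool" where
  "state_inv H i0 (Select M A) \<longleftrightarrow> list_inv H i0 M A \<and> (\<forall>e\<in>set A. blocking M e \<noteq> {})"
| "state_inv H i0 (Check M A) \<longleftrightarrow> list_inv H i0 M A \<and> (\<forall>e\<in>set (butlast A). blocking M e \<noteq> {})"
| "state_inv H i0 (Return M) \<longleftrightarrow> True"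

text \<open>Dropping \<open>e'\<close> frees the player of \<open>e\<close>, and no matching edge
  meets the resources of \<open>e\<close>.\<close>

lemma matching_exchange:
  assumes M: "matching H M" and e: "e \<in> H" "blocking M e = {}" and e': "e' \<in> M" "fst e' = fst e"
  shows "matching H ((M - {e'}) \<union> {e})"
  unfolding matching_def
proof (intro conjI ballI impI)
  have player: "fst f \<noteq> fst e" if "f \<in> M - {e'}" for f
    using M e' that unfolding matching_def by fastforce
  have resource: "snd f \<inter> snd e = {}" if "f \<in> M" for f
    using e(2) that unfolding blocking_def by blast
  show "M - {e'} \<union> {e} \<subseteq> H" using M e(1) by (auto simp: matching_def)
  fix f g assume fg: "f \<in> M - {e'} \<union> {e}" "g \<in> M - {e'} \<union> {e}" "f \<noteq> g"
  show "fst f \<noteq> fst g" using fg M player[of f] player[of g] by (auto simp: matching_def)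
  show "snd f \<inter> snd g = {}"
    using fg M resource[of f] resource[of g] unfolding matching_def by blast
qed

text \<open>The exchange keeps the blocking sets of all edges before position \<open>k\<close>. Only
  \<open>A ! k\<close> loses the blocking edge \<open>e'\<close>, and \<open>Check\<close> allows
  its last edge to be unblocked.\<close>

lemma state_inv_swap:
  assumes inv: "state_inv H i0 (Check M A)" and A: "A \<noteq> []" and free: "blocking M (last A) = {}"
    and e': "e' \<in> blocking_list M A" "fst e' = fst (last A)"
    and k: "k < length A" "e' \<in> blocking M (A ! k)"
  shows "state_inv H i0 (Check ((M - {e'}) \<union> {last A}) (take (Suc k) A))"
proof -
  let ?r = "\<lambda>M e e'. snd e' \<inter> (snd e \<union> resources (blocking M e)) = {}"
  let ?M = "(M - {e'}) \<union> {last A}"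
  have L: "matching H M" "i0 \<notin> players M" "set A \<subseteq> H" "sorted_wrt (?r M) A"
    using inv by (auto simp: list_inv_def)
  have ne: "\<forall>e\<in>set (butlast A). blocking M e \<noteq> {}" using inv by simp
  have e'M: "e' \<in> M" using k by (simp add: blocking_def)
  have kl: "k < length A - 1"
  proof (rule ccontr)
    assume "\<not> k < length A - 1"
    then have "k = length A - 1" using k(1) by linarith
    then have "A ! k = last A" using A by (simp add: last_conv_nth)
    then show False using free k(2) by simp
  qed
  have lastA: "last A = A ! (length A - 1)" using A by (simp add: last_conv_nth)
  have rel: "?r M (A ! l) (A ! m)" if "l < m" "m < length A" for l m
    using L(4) that by (simp add: sorted_wrt_iff_nth_less)
  have blk: "blocking ?M (A ! l) = blocking M (A ! l)" if l: "l < k" for l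
  proof -
    \<comment> \<open>\<open>e'\<close> meets \<open>A ! k\<close>, which avoids the blocking edges
      of every earlier edge.\<close>
    have "e' \<notin> blocking M (A ! l)"
    proof
      assume "e' \<in> blocking M (A ! l)"
      then have "snd (A ! k) \<inter> snd e' = {}" using rel[OF l k(1)] by (auto simp: resources_def)
      then show False using k(2) by (auto simp: blocking_def)
    qed
    moreover have "snd (last A) \<inter> snd (A ! l) = {}"
      using rel[of l "length A - 1"] l kl unfolding lastA by fastforce
    ultimately show ?thesis by (auto simp: blocking_def)
  qed
  have "last A \<in> H" using L(3) A by auto
  then have "matching H ?M" using matching_exchange[OF L(1) _ free e'M e'(2)] by blast
  \<comment> \<open>The new edge has the player of \<open>e'\<close>, who was already matched and so
    is not \<open>i0\<close>.\<close>
  moreover have "i0 \<notin> players ?M" using L(2) e'M e'(2) imageI[OF e'M, of fst] by (auto simp: players_def)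
  moreover have "set (take (Suc k) A) \<subseteq> H" using L(3) set_take_subset by fast
  moreover have "sorted_wrt (?r ?M) (take (Suc k) A)"
    using rel blk k(1) by (auto simp: sorted_wrt_iff_nth_less)
  moreover have "blocking ?M e \<noteq> {}" if e: "e \<in> set (butlast (take (Suc k) A))" for e
  proof -
    have "butlast (take (Suc k) A) = take k A" using k(1) by (simp add: butlast_take)
    then obtain l where l: "l < k" "e = A ! l" using e k(1) by (auto simp: in_set_conv_nth)
    have "A ! l = butlast A ! l" "l < length (butlast A)" using l kl by (auto simp: nth_butlast)
    then have "A ! l \<in> set (butlast A)" by (metis nth_mem)
    then show ?thesis using blk[OF l(1)] l(2) ne by auto
  qed
  ultimately show ?thesis by (simp add: list_inv_def)
qed

lemma state_inv_step:
  assumes "step H i0 s s'" "state_inv H i0 s"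
  shows "state_inv H i0 s'"
  using assms
proof cases
  case (select e M A)
  have "snd e \<inter> (snd e' \<union> resources (blocking M e')) = {}" if "e' \<in> set A" for e'
    using that select(4) by (auto simp: resources_def blocking_list_def)
  then show ?thesis using select assms(2) by (simp add: list_inv_def sorted_wrt_append)
next
  case (blocked A M)
  have "set A = insert (last A) (set (butlast A))"
    using blocked(3) by (metis append_butlast_last_id list.simps(15) rotate1.simps(2) set_rotate1)
  then show ?thesis using blocked assms(2) by auto
next
  case (swap A M e' k)
  then show ?thesis using state_inv_swap[of H i0 M A e' k] assms(2) by simp
next
  case (finish A M)
  then show ?thesis by simp
qed

lemma state_inv_steps:
  assumes "(step H i0)\<^sup>*\<^sup>* s s'" "state_inv H i0 s"
  shows "state_inv H i0 s'"
  using assms by (induction rule: rtranclp_induct) (simp_all add: state_inv_step)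

text \<open>A common blocking edge would meet the later of the two edges, which avoids all blocking
  edges of the earlier one.\<close>

lemma blocking_disjoint:
  assumes "list_inv H i0 M A" "e \<in> set A" "e' \<in> set A" "e \<noteq> e'"
  shows "blocking M e \<inter> blocking M e' = {}"
proof -
  have gen: "blocking M (A ! l) \<inter> blocking M (A ! m) = {}" if "l < m" "m < length A" for l m
  proof -
    have "snd (A ! m) \<inter> resources (blocking M (A ! l)) = {}"
      using assms(1) that by (auto simp: list_inv_def sorted_wrt_iff_nth_less)
    then show ?thesis by (auto simp: blocking_def resources_def)
  qed
  obtain l m where lm: "l < length A" "m < length A" "e = A ! l" "e' = A ! m"
    using assms(2,3) by (metis in_set_conv_nth)
  then show ?thesis using gen[of l m] gen[of m l] assms(4) by (cases l m rule: linorder_cases) auto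
qed

section \<open>Existence of an addable edge\<close>

lemma hyperedges_minimal_heavy:
  assumes "lp_opt P R v Rs > 0" and w: "w = (\<lambda>j. v j / (lp_opt P R v Rs / alpha))"
  shows "(i, C) \<in> hyperedges P R v Rs \<longleftrightarrow> i \<in> P \<and> C \<subseteq> Rs i \<and> minimal_heavy w C"
proof -
  have "lp_opt P R v Rs / alpha > 0" using assms by (simp add: alpha_def)
  then have "sum w D < 1 \<longleftrightarrow> sum v D < lp_opt P R v Rs / alpha" for D
    by (simp only: w sum_divide_distrib[symmetric] divide_less_eq_1_pos)
  then show ?thesis by (simp add: hyperedges_def minimal_heavy_def not_less[symmetric])
qed

lemma addable_edge_exists:
  assumes fin: "finite P" "finite R"
    and pos: "\<And>j. j \<in> R \<Longrightarrow> v j > 0"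
    and sub: "\<And>i. i \<in> P \<Longrightarrow> Rs i \<subseteq> R"
    and i0: "i0 \<in> P"
    and inv: "state_inv (hyperedges P R v Rs) i0 (Select M A)"
  shows "\<exists>e \<in> hyperedges P R v Rs - M.
           snd e \<inter> (resources (set A) \<union> resources (blocking_list M A)) = {} \<and>
           fst e \<in> players (blocking_list M A) \<union> {i0}"
proof (cases "lp_opt P R v Rs > 0")
  case False
  \<comment> \<open>With a threshold of at most \<open>0\<close> the empty set qualifies, and it has
    no proper subset.\<close>
  have "(i0, {}) \<in> hyperedges P R v Rs"
    using False i0 by (simp add: hyperedges_def alpha_def)
  moreover have "(i0, {}) \<notin> M"
    using inv by (force simp: list_inv_def players_def)
  ultimately show ?thesis by force
next
  case True
  let ?H = "hyperedges P R v Rs"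
  define \<tau> where "\<tau> = lp_opt P R v Rs"
  define w where "w = (\<lambda>j. v j / (\<tau> / alpha))"
  define B where "B = blocking_list M A"
  define X where "X = resources (set A) \<union> resources B"
  define Q where "Q = insert i0 (players B)"
  note mh = hyperedges_minimal_heavy[OF True w_def[unfolded \<tau>_def]]
  have \<tau>: "\<tau> / alpha > 0" using True by (simp add: \<tau>_def alpha_def)
  have L: "matching ?H M" "i0 \<notin> players M" "set A \<subseteq> ?H"
    and ne: "\<And>e. e \<in> set A \<Longrightarrow> blocking M e \<noteq> {}"
    using inv by (auto simp: list_inv_def)
  have MH: "M \<subseteq> ?H" using L by (simp add: matching_def)
  have BM: "B \<subseteq> M" by (auto simp: B_def blocking_list_def blocking_def)
  have "?H \<subseteq> P \<times> Pow R" using sub by (auto simp: hyperedges_def)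
  then have finM: "finite M" using MH fin finite_subset[of M "P \<times> Pow R"] by auto
  have HR: "snd e \<subseteq> R" "fst e \<in> P" "minimal_heavy w (snd e)" if "e \<in> ?H" for e
    using that sub mh[of "fst e" "snd e"] by auto
  have XR: "X \<subseteq> R" using HR(1) L(3) BM MH by (fastforce simp: X_def resources_def)
  have QP: "Q \<subseteq> P" using HR(2) BM MH i0 by (auto simp: Q_def players_def)
  have wpos: "w j \<ge> 0" if "j \<in> R" for j 
    unfolding w_def by (rule divide_nonneg_pos[OF less_imp_le[OF pos[OF that]] \<tau>])
  show ?thesis
  proof (rule ccontr)
    assume none: "\<not> ?thesis"
    \<comment> \<open>Otherwise \<open>C - X\<close> contains an edge \<open>(i, D)\<close>. It is
      not in \<open>M\<close>: the only edge of \<open>M\<close> at a player of \<open>Q\<close>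
      lies in \<open>B\<close>, so \<open>D\<close> would lie in \<open>X\<close>. Thus it could be
      added.\<close>
    have outside: "sum w (C - X) < 1" if i: "i \<in> Q" and C: "C \<subseteq> Rs i" for i C
    proof (rule ccontr)
      assume "\<not> sum w (C - X) < 1"
      moreover have "finite (C - X)" using C i QP sub fin by (meson finite_Diff finite_subset subsetD)
      ultimately obtain D where D: "D \<subseteq> C - X" "minimal_heavy w D"
        using exists_minimal_heavy_subset[of "C - X" w] by auto
      have DH: "(i, D) \<in> ?H" using mh[of i D] D C i QP by blast
      have "(i, D) \<notin> M"
      proof
        assume DM: "(i, D) \<in> M"
        then have "i \<noteq> i0" using L(2) by (force simp: players_def)
        then obtain b where b: "b \<in> B" "fst b = i" using i by (auto simp: Q_def players_def)
        then have "b = (i, D)" using L(1) DM BM unfolding matching_def by fastforce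
        then have "D \<subseteq> X" using b by (auto simp: X_def resources_def)
        then show False using D minimal_heavy_nonempty by blast
      qed
      moreover have "D \<inter> X = {}" using D(1) by blast
      ultimately show False
        using none DH i by (auto simp: X_def Q_def B_def dest!: bspec[where x = "(i, D)"])
    qed
    define z where "z = (\<lambda>j. if j \<in> X then dual_val (w j) else 0)"
    define y :: "'a \<Rightarrow> real" where "y = (\<lambda>i. if i \<in> Q then 1 else 0)"
    have z0: "z j \<ge> 0" if "j \<in> R" for j using wpos[OF that] by (simp add: z_def dual_val_nonneg)
    have yz: "y i \<le> sum z C" if i: "i \<in> P" and C: "C \<in> configs v Rs i \<tau>" for i C
    proof -
      have CR: "C \<subseteq> R" "C \<subseteq> Rs i" "sum v C \<ge> \<tau>" using C sub[OF i] by (auto simp: configs_def)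
      have finC: "finite C" using CR(1) fin finite_subset by blast
      show ?thesis
      proof (cases "i \<in> Q")
        case False
        then show ?thesis using CR z0 by (auto simp: y_def intro!: sum_nonneg)
      next
        case iQ: True
        have "sum w C = sum v C / (\<tau> / alpha)" by (simp only: w_def sum_divide_distrib)
        also have "\<dots> \<ge> \<tau> / (\<tau> / alpha)" using CR(3) \<tau> by (intro divide_right_mono) auto
        \<comment> \<open>\<open>23/6\<close> is \<open>alpha\<close>; losing less than
          \<open>1\<close> outside \<open>X\<close> leaves more than \<open>17/6\<close>.\<close>
        finally have "sum w C \<ge> 23/6" using True by (simp add: \<tau>_def alpha_def)
        moreover have "sum w C = sum w (C \<inter> X) + sum w (C - X)"
          using sum.Int_Diff[OF finC] by blast
        ultimately have "sum w (C \<inter> X) > 17/6" using outside[OF iQ CR(2)] by simp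
        then have "(\<Sum>j\<in>C \<inter> X. dual_val (w j)) \<ge> 1"
          using finC CR(1) wpos by (intro dual_val_cover) auto
        also have "(\<Sum>j\<in>C \<inter> X. dual_val (w j)) = sum z C"
          using finC by (simp add: z_def sum.inter_restrict)
        finally show ?thesis by (simp add: y_def iQ)
      qed
    qed
    have "sum y P \<le> sum z R"
      by (rule lp_feasible_weak_duality[of P R v Rs \<tau>])
        (use lp_opt_greatest(1)[of P R Rs v] fin sub i0 z0 yz in \<open>auto simp: \<tau>_def y_def\<close>)
    \<comment> \<open>Distinct edges of \<open>B\<close> have distinct players; the extra
      \<open>1\<close> is the unmatched \<open>i0\<close>, and it produces the
      contradiction.\<close>
    moreover have "sum y P = card B + 1"
    proof -
      have "inj_on fst B" using L(1) BM unfolding matching_def by (intro inj_onI) blast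
      then have "card (players B) = card B" by (simp add: players_def card_image)
      moreover have "i0 \<notin> players B" using L(2) BM by (auto simp: players_def)
      moreover have "finite (players B)" using finM BM finite_subset by (auto simp: players_def)
      ultimately have "card Q = card B + 1" by (simp add: Q_def)
      moreover have "sum y P = card (P \<inter> Q)" using fin by (simp add: y_def sum.inter_restrict[symmetric])
      ultimately show ?thesis using QP by (simp add: Int_absorb1)
    qed
    moreover have "sum z R \<le> card B"
    proof -
      \<comment> \<open>\<open>X\<close> is regrouped by the edges of \<open>A\<close>, so that the
        packing bound applies to each edge with its own blocking edges.\<close>
      define N where "N = (\<lambda>e. snd e \<union> (\<Union>b\<in>blocking M e. snd b))"
      have XN: "X = (\<Union>e\<in>set A. N e)"
        by (auto simp: X_def N_def B_def resources_def blocking_list_def)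
      have finN: "finite (N e)" if "e \<in> set A" for e
        using that XN XR fin finite_subset[of "N e" R] by blast
      have finb: "finite (blocking M e)" for e using finM by (simp add: blocking_def)
      have "sum z R = (\<Sum>j\<in>X. dual_val (w j))"
        using XR fin by (simp add: z_def sum.inter_restrict[symmetric] Int_absorb1)
      also have "\<dots> \<le> (\<Sum>e\<in>set A. \<Sum>j\<in>N e. dual_val (w j))"
        unfolding XN using finN XN XR wpos dual_val_nonneg by (intro sum_UN_le_sum) blast+
      also have "\<dots> \<le> (\<Sum>e\<in>set A. real (card (blocking M e)))"
      proof (rule sum_mono)
        fix e assume e: "e \<in> set A"
        have "minimal_heavy w (snd b) \<and> snd b \<inter> snd e \<noteq> {}" if "b \<in> blocking M e" for b
          using that MH HR(3)[of b] by (auto simp: blocking_def)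
        moreover have "minimal_heavy w (snd e)" using e L(3) HR(3) by blast
        moreover have "w j \<ge> 0" if "j \<in> N e" for j using that e XN XR wpos by blast
        ultimately show "(\<Sum>j\<in>N e. dual_val (w j)) \<le> card (blocking M e)"
          unfolding N_def using dual_val_pack[OF _ finb ne[OF e]] by blast
      qed
      \<comment> \<open>Each blocking edge belongs to only one edge of \<open>A\<close>, so nothing
        is counted twice.\<close>
      also have "\<dots> = card B"
        unfolding B_def blocking_list_def
        using blocking_disjoint[of ?H i0 M A] inv finb
        by (subst card_UN_disjoint) (simp_all del: split_paired_All)
      finally show ?thesis .
    qed
    ultimately show False by simp
  qed
qed

theorem theorem3:
  fixes P :: "'p set" and R :: "'r set" and v :: "'r \<Rightarrow> real" and Rs :: "'p \<Rightarrow> 'r set"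
    and M M' :: "('p, 'r) edge set" and i0 :: 'p and A :: "('p, 'r) edge list"
  assumes "finite P" and "finite R"
    and "\<And>j. j \<in> R \<Longrightarrow> v j > 0"
    and "\<And>i. i \<in> P \<Longrightarrow> Rs i \<subseteq> R"
    and "matching (hyperedges P R v Rs) M"
    and "i0 \<in> P" and "i0 \<notin> players M"
    and "(step (hyperedges P R v Rs) i0)\<^sup>*\<^sup>* (Select M []) (Select M' A)"
  shows "\<exists>e \<in> hyperedges P R v Rs - M'.
           snd e \<inter> (resources (set A) \<union> resources (blocking_list M' A)) = {} \<and>
           fst e \<in> players (blocking_list M' A) \<union> {i0}"
proof -
  have "state_inv (hyperedges P R v Rs) i0 (Select M [])"
    using assms(5,7) by (simp add: list_inv_def)
  from addable_edge_exists[OF assms(1-4,6) state_inv_steps[OF assms(8) this]] show ?thesis .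
qed

end
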